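(* Let $0<\alpha<1$, and let $D\subset\mathbb R$ be nonempty and bounded. The following are equivalent. (i) $D$ is uniformly disconnected. (ii) For every metric space $(X,d)$ and every $\alpha$-Hölder map $F:D\to\mathcal K(X)$, there exists an $\alpha$-Hölder selection of $F$. (iii) There exists $C=C(D,\alpha)<\infty$ such that, for every metric space $(X,d)$, every $\alpha$-Hölder map $F:D\to\mathcal K(X)$, every $u_*\in D$, and every $x_*\in F(u_* )$, there exists a selection $f:D\to X$ of $F$ satisfying $$f(u_* )=x_*,\qquad [f]_{\alpha,D}\le C[F]_{\alpha,D}.$$ If $D$ is $c$-uniformly disconnected for some $c\in(0,1]$, one may take $C=8c^{-\alpha}$ in (iii).
   Context: For a metric space $(X,d)$, $\mathcal K(X)$ is the family of nonempty compact subsets of $X$, with Hausdorff distance $d_H$. A map $F:D\to\mathcal K(X)$ is $\alpha$-Hölder if there is $L\ge0$ with $d_H(F(u),F(v))\le L|u-v|^\alpha$ for all $u,v\in D$; the least such $L$ is $[F]_{\alpha,D}$. For single-valued $f:D\to X$, being $\alpha$-Hölder and $[f]_{\alpha,D}$ are defined analogously with $d$ in place of $d_H$. A selection of $F$ is a map $f:D\to X$ with $f(u)\in F(u)$ for every $u\in D$. For $c\in(0,1]$, $D$ is $c$-uniformly disconnected if, for every pair of distinct points $u,v\in D$ and every finite chain $u=u_0,u_1,\ldots,u_N=v$ with all $u_i\in D$, one has $\max_{1\le i\le N}|u_i-u_{i-1}|\ge c|u-v|$. $D$ is uniformly disconnected if it is $c$-uniformly disconnected for some $c\in(0,1]$.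 *)

theory Defs
  imports "HOL-Analysis.Analysis"
begin

definition nonempty_compacts :: "'a metric \<Rightarrow> 'a set set" where
  "nonempty_compacts X = {K. compactin (mtopology_of X) K \<and> K \<noteq> {}}"

definition hausdorff_dist :: "'a metric \<Rightarrow> 'a set \<Rightarrow> 'a set \<Rightarrow> real" where
  "hausdorff_dist X A B =
     max (SUP a\<in>A. INF b\<in>B. mdist X a b) (SUP b\<in>B. INF a\<in>A. mdist X a b)"

text \<open>
  The distance \<open>e\<close> on the target is a parameter, so that the same definitions serve
  set-valued maps (\<open>e = hausdorff_dist X\<close>) and single-valued maps (\<open>e = mdist X\<close>).
\<close>

definition holder_bound ::
    "real \<Rightarrow> real set \<Rightarrow> ('b \<Rightarrow> 'b \<Rightarrow> real) \<Rightarrow> (real \<Rightarrow> 'b) \<Rightarrow> real \<Rightarrow> bool" where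
  "holder_bound \<alpha> D e g L \<longleftrightarrow>
     0 \<le> L \<and> (\<forall>u\<in>D. \<forall>v\<in>D. e (g u) (g v) \<le> L * \<bar>u - v\<bar> powr \<alpha>)"

definition holder_on ::
    "real \<Rightarrow> real set \<Rightarrow> ('b \<Rightarrow> 'b \<Rightarrow> real) \<Rightarrow> (real \<Rightarrow> 'b) \<Rightarrow> bool" where
  "holder_on \<alpha> D e g \<longleftrightarrow> (\<exists>L. holder_bound \<alpha> D e g L)"

definition holder_const ::
    "real \<Rightarrow> real set \<Rightarrow> ('b \<Rightarrow> 'b \<Rightarrow> real) \<Rightarrow> (real \<Rightarrow> 'b) \<Rightarrow> real" where
  "holder_const \<alpha> D e g = (LEAST L. holder_bound \<alpha> D e g L)"

text \<open>The least constant is attained for every map that is \<open>\<alpha>\<close>-Hoelder:\<close>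

lemma holder_const_least:
  assumes "holder_on \<alpha> D e g"
  shows "holder_bound \<alpha> D e g (holder_const \<alpha> D e g)"
    and "\<And>L. holder_bound \<alpha> D e g L \<Longrightarrow> holder_const \<alpha> D e g \<le> L"
proof -
  let ?S = "{L. holder_bound \<alpha> D e g L}"
  have ne: "?S \<noteq> {}" using assms by (auto simp: holder_on_def)
  have bdd: "bdd_below ?S" by (rule bdd_belowI[of _ 0]) (auto simp: holder_bound_def)
  have 1: "holder_bound \<alpha> D e g (Inf ?S)"
  proof (subst holder_bound_def, intro conjI ballI)
    show "0 \<le> Inf ?S" using ne by (rule cInf_greatest) (auto simp: holder_bound_def)
    fix u v assume uv: "u \<in> D" "v \<in> D"
    show "e (g u) (g v) \<le> Inf ?S * \<bar>u - v\<bar> powr \<alpha>"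
    proof (cases "u = v")
      case True
      from ne obtain L where "holder_bound \<alpha> D e g L" by blast
      with uv have "e (g u) (g v) \<le> L * \<bar>u - v\<bar> powr \<alpha>"
        by (simp add: holder_bound_def)
      with True show ?thesis by simp
    next
      case False
      then have pos: "0 < \<bar>u - v\<bar> powr \<alpha>" by simp
      have "e (g u) (g v) / \<bar>u - v\<bar> powr \<alpha> \<le> Inf ?S"
      proof (rule cInf_greatest[OF ne])
        fix L assume "L \<in> ?S"
        with uv pos show "e (g u) (g v) / \<bar>u - v\<bar> powr \<alpha> \<le> L"
          by (auto simp: holder_bound_def divide_le_eq)
      qed
      with pos show ?thesis by (simp add: divide_le_eq)
    qed
  qed
  have 2: "Inf ?S \<le> L" if "holder_bound \<alpha> D e g L" for L
    using that bdd by (auto intro: cInf_lower)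
  have eq: "holder_const \<alpha> D e g = Inf ?S"
    unfolding holder_const_def using 1 2 by (rule Least_equality)
  show "holder_bound \<alpha> D e g (holder_const \<alpha> D e g)" using 1 eq by simp
  show "holder_const \<alpha> D e g \<le> L" if "holder_bound \<alpha> D e g L" for L
    using 2[OF that] eq by simp
qed

definition holder_setmap :: "real \<Rightarrow> real set \<Rightarrow> 'a metric \<Rightarrow> (real \<Rightarrow> 'a set) \<Rightarrow> bool" where
  "holder_setmap \<alpha> D X F \<longleftrightarrow>
     F \<in> D \<rightarrow> nonempty_compacts X \<and> holder_on \<alpha> D (hausdorff_dist X) F"

definition selection_on :: "real set \<Rightarrow> (real \<Rightarrow> 'a set) \<Rightarrow> (real \<Rightarrow> 'a) \<Rightarrow> bool" where
  "selection_on D F f \<longleftrightarrow> (\<forall>u\<in>D. f u \<in> F u)"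

definition holder_selections :: "real \<Rightarrow> real set \<Rightarrow> 'a metric \<Rightarrow> bool" where
  "holder_selections \<alpha> D X \<longleftrightarrow>
     (\<forall>F. holder_setmap \<alpha> D X F \<longrightarrow>
        (\<exists>f. selection_on D F f \<and> holder_on \<alpha> D (mdist X) f))"

text \<open>
  \<open>holder_on\<close> is required explicitly below because \<open>holder_const\<close> is only meaningful
  for maps that are \<open>\<alpha>\<close>-Hoelder.
\<close>

definition pointed_holder_selections :: "real \<Rightarrow> real set \<Rightarrow> real \<Rightarrow> 'a metric \<Rightarrow> bool" where
  "pointed_holder_selections \<alpha> D C X \<longleftrightarrow>
     (\<forall>F. holder_setmap \<alpha> D X F \<longrightarrow>
        (\<forall>u0\<in>D. \<forall>x0\<in>F u0. \<exists>f. selection_on D F f \<and> f u0 = x0 \<and>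
           holder_on \<alpha> D (mdist X) f \<and>
           holder_const \<alpha> D (mdist X) f \<le> C * holder_const \<alpha> D (hausdorff_dist X) F))"

text \<open>
  A chain is \<open>w 0, \<dots>, w N\<close>; the end points being distinct forces \<open>N \<ge> 1\<close>, so the
  maximum is over a nonempty set.
\<close>

definition c_uniformly_disconnected :: "real \<Rightarrow> real set \<Rightarrow> bool" where
  "c_uniformly_disconnected c D \<longleftrightarrow>
     (\<forall>u\<in>D. \<forall>v\<in>D. u \<noteq> v \<longrightarrow>
        (\<forall>N (w :: nat \<Rightarrow> real). w 0 = u \<and> w N = v \<and> (\<forall>i\<le>N. w i \<in> D) \<longrightarrow>
           (MAX i\<in>{1..N}. \<bar>w i - w (i - 1)\<bar>) \<ge> c * \<bar>u - v\<bar>))"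

definition uniformly_disconnected :: "real set \<Rightarrow> bool" where
  "uniformly_disconnected D \<longleftrightarrow> (\<exists>c. 0 < c \<and> c \<le> 1 \<and> c_uniformly_disconnected c D)"

text \<open>
  Quantifying over all metric spaces. HOL cannot quantify over types inside a formula, so
  ``for every metric space'' ranges over all metric spaces whose points are drawn from an
  arbitrary type \<open>'a\<close> (a free, hence universally quantified, type variable) and in
  addition over those whose points are drawn from \<open>real\<close>. The second family is needed
  because for a small \<open>'a\<close>, say a singleton type, the selection properties hold for every
  \<open>D\<close>. The type \<open>real\<close> is large enough because the union of the values of an
  \<open>\<alpha>\<close>-Hoelder map with \<open>\<alpha> > 0\<close> and nonempty compact values on a subset of the real
  line is separable, hence has at most continuum many points.
\<close>

end

theory Submission
  imports Defs
begin

text \<open>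
  If \<open>D\<close> is \<open>c\<close>-uniformly disconnected, then being linked by a chain of steps with
  \<open>\<bar>a - b\<bar> powr \<alpha> \<le> R / 2 ^ k\<close> gives nested partitions \<open>E k\<close> of \<open>D\<close>, and \<open>F\<close> varies by at most
  \<open>L / 2 ^ k\<close>, \<open>L = [F] * c powr (- \<alpha>) * R\<close>, on a class of \<open>E k\<close>. Choosing a centre in every
  class and a nearest point of \<open>F\<close> at the new centre when passing to the next scale produces maps
  that are constant on the classes and whose limit is a selection with oscillation at most
  \<open>4 * L / 2 ^ k\<close> on the classes of \<open>E k\<close>.

  Conversely, if \<open>D\<close> is not uniformly disconnected, it contains at arbitrarily small scales \<open>l\<close>
  chains of diameter \<open>l\<close> with steps shorter than \<open>c * l\<close>, for every \<open>c\<close>. A circle of radius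
  \<open>A * l powr \<alpha>\<close> with a small gap that rotates twice along such a chain has Hoelder constant at most
  \<open>1\<close> (here \<open>\<alpha> < 1\<close> is used), while the gap drags every selection along at a speed exceeding \<open>A\<close>.
  The product of such maps with \<open>A\<close> tending to infinity has no Hoelder selection.
\<close>

section \<open>The Hausdorff distance of compact sets\<close>

lemma hausdorff_dist_leI:
  assumes "A \<noteq> {}" "B \<noteq> {}"
    and AB: "\<And>a. a \<in> A \<Longrightarrow> \<exists>b\<in>B. mdist X a b \<le> r"
    and BA: "\<And>b. b \<in> B \<Longrightarrow> \<exists>a\<in>A. mdist X a b \<le> r"
  shows "hausdorff_dist X A B \<le> r"
proof -
  have bdd: "bdd_below (g ` S)" if "\<And>x. 0 \<le> g x" for g :: "'a \<Rightarrow> real" and S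
    using that by (intro bdd_belowI2[of _ 0]) auto
  have "(SUP a\<in>A. INF b\<in>B. mdist X a b) \<le> r"
    using assms(1) AB by (intro cSUP_least) (meson bdd mdist_nonneg cINF_lower2)+
  moreover have "(SUP b\<in>B. INF a\<in>A. mdist X a b) \<le> r"
    using assms(2) BA by (intro cSUP_least) (meson bdd mdist_nonneg cINF_lower2)+
  ultimately show ?thesis
    by (simp add: hausdorff_dist_def)
qed

lemma nonempty_compacts_subset_mspace: "K \<in> nonempty_compacts X \<Longrightarrow> K \<subseteq> mspace X"
  using compactin_subset_topspace by (fastforce simp: nonempty_compacts_def)

lemma compact_mdist_image:
  assumes "K \<in> nonempty_compacts X" "a \<in> mspace X"
  shows "compact (mdist X a ` K)"
proof -
  have "compactin euclidean (mdist X a ` K)"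
    using assms by (intro image_compactin[OF _ continuous_on_mdist]) (auto simp: nonempty_compacts_def)
  then show ?thesis by simp
qed

lemma nearest_point_exists:
  assumes "K \<in> nonempty_compacts X" "a \<in> mspace X"
  shows "\<exists>b\<in>K. \<forall>y\<in>K. mdist X a b \<le> mdist X a y"
proof -
  have "\<exists>s\<in>mdist X a ` K. \<forall>t\<in>mdist X a ` K. s \<le> t"
    using assms compact_mdist_image[OF assms]
    by (intro compact_attains_inf) (auto simp: nonempty_compacts_def)
  then show ?thesis by blast
qed

text \<open>Compactness enters twice: the infimum over \<open>B\<close> is attained, and distances
  from a fixed point of \<open>B\<close> are bounded on \<open>A\<close>, so that the supremum over
  \<open>A\<close> in \<open>hausdorff_dist\<close> is a genuine upper bound.\<close>

lemma hausdorff_dist_nearest: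
  assumes A: "A \<in> nonempty_compacts X" and B: "B \<in> nonempty_compacts X" and a: "a \<in> A"
  shows "\<exists>b\<in>B. mdist X a b \<le> hausdorff_dist X A B"
proof -
  have aX: "a \<in> mspace X"
    using A a nonempty_compacts_subset_mspace by blast
  obtain b where b: "b \<in> B" "\<forall>y\<in>B. mdist X a b \<le> mdist X a y"
    using nearest_point_exists[OF B aX] by blast
  have "b \<in> mspace X"
    using B b(1) nonempty_compacts_subset_mspace by blast
  obtain M where M: "\<And>x. x \<in> A \<Longrightarrow> mdist X b x \<le> M"
    using bounded_imp_bdd_above[OF compact_imp_bounded[OF compact_mdist_image[OF A \<open>b \<in> mspace X\<close>]]]
    by (auto simp: bdd_above_def)
  have bdd: "bdd_below (mdist X x ` B)" for x
    by (intro bdd_belowI2[of _ 0]) auto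
  have "(INF y\<in>B. mdist X x y) \<le> M" if "x \<in> A" for x
    using cINF_lower2[OF bdd b(1), of x M] M[OF that] by (simp add: mdist_commute)
  then have bddA: "bdd_above ((\<lambda>x. INF y\<in>B. mdist X x y) ` A)"
    by (auto simp: bdd_above_def)
  have "mdist X a b \<le> (INF y\<in>B. mdist X a y)"
    using b by (intro cINF_greatest) auto
  also have "\<dots> \<le> (SUP x\<in>A. INF y\<in>B. mdist X x y)"
    using cSUP_upper[OF a bddA] .
  also have "\<dots> \<le> hausdorff_dist X A B"
    by (simp add: hausdorff_dist_def)
  finally show ?thesis using b(1) by blast
qed

section \<open>Selections on uniformly disconnected sets\<close>

lemma mdist_self [simp]: "x \<in> mspace X \<Longrightarrow> mdist X x x = 0"
  by simp

text \<open>The centres of \<open>u\<close> at scales \<open>k\<close> and \<open>Suc k\<close> lie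
  in one class of \<open>E k\<close>, so the approximation \<open>g k u\<close> moves by at most
  \<open>L / 2 ^ k\<close> and its tail is at most \<open>2 * L / 2 ^ k\<close>. Points of one class
  share \<open>g k\<close>; two tails give the factor 4. The limit comes from compactness of
  \<open>F u\<close>, since \<open>X\<close> is not assumed complete.\<close>

lemma nested_partition_selection:
  assumes equiv: "\<And>k. equiv D (E k)"
    and top: "E 0 = D \<times> D"
    and anti: "\<And>k. E (Suc k) \<subseteq> E k"
    and F: "\<And>u. u \<in> D \<Longrightarrow> F u \<in> nonempty_compacts X"
    and H: "\<And>k u v. (u, v) \<in> E k \<Longrightarrow> hausdorff_dist X (F u) (F v) \<le> L / 2 ^ k"
    and L: "0 \<le> L"
    and u0: "u0 \<in> D" and x0: "x0 \<in> F u0"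
  obtains f where "\<And>u. u \<in> D \<Longrightarrow> f u \<in> F u" "f u0 = x0"
    "\<And>k u v. (u, v) \<in> E k \<Longrightarrow> mdist X (f u) (f v) \<le> 4 * L / 2 ^ k"
proof -
  have FX: "F u \<subseteq> mspace X" if "u \<in> D" for u
    using F[OF that] nonempty_compacts_subset_mspace by blast
  have ED: "u \<in> D \<and> v \<in> D" if "(u, v) \<in> E k" for u v k
    using equiv_type[OF equiv[of k]] that by blast
  \<comment> \<open>The class of \<open>u0\<close> has centre \<open>u0\<close> at every scale,
    which keeps \<open>g k u0\<close> equal to \<open>x0\<close>; elsewhere the choice depends on
    the class alone.\<close>
  define cen where "cen k u = (if (u, u0) \<in> E k then u0 else SOME v. (u, v) \<in> E k)" for k u
  have refl: "(u, u) \<in> E k" if "u \<in> D" for u k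
    using equiv[of k] that unfolding equiv_def by (meson refl_onD)
  have sym: "(v, u) \<in> E k" if "(u, v) \<in> E k" for u v k
    using equiv[of k] that unfolding equiv_def by (meson symE)
  have trans: "(u, w) \<in> E k" if "(u, v) \<in> E k" "(v, w) \<in> E k" for u v w k
    using equiv[of k] that unfolding equiv_def by (meson transE)
  have cen: "(u, cen k u) \<in> E k" if "u \<in> D" for k u
    using someI[of "\<lambda>v. (u, v) \<in> E k", OF refl[OF that]] by (simp add: cen_def)
  have cenD: "cen k u \<in> D" if "u \<in> D" for k u
    using ED[OF cen[OF that]] by blast
  have cen_cong: "cen k u = cen k v" if "(u, v) \<in> E k" for k u v
  proof -
    have "(u, w) \<in> E k \<longleftrightarrow> (v, w) \<in> E k" for w
      using trans[OF that] trans[OF sym[OF that]] by blast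
    then show ?thesis by (simp add: cen_def)
  qed
  have cen_u0: "cen k u0 = u0" for k
    using refl[OF u0] by (simp add: cen_def)
  define near where "near K x = (SOME b. b \<in> K \<and> (\<forall>y\<in>K. mdist X x b \<le> mdist X x y))" for K x
  have near: "near (F u) x \<in> F u \<and> (\<forall>y\<in>F u. mdist X x (near (F u) x) \<le> mdist X x y)"
    if "u \<in> D" "x \<in> mspace X" for u x
    using someI_ex[OF nearest_point_exists[OF F[OF that(1)] that(2), unfolded Bex_def]]
    by (simp add: near_def)
  have near_le: "mdist X x (near (F v) x) \<le> L / 2 ^ k" if E: "(u, v) \<in> E k" and x: "x \<in> F u" for u v x k
  proof -
    have uv: "u \<in> D" "v \<in> D" using ED[OF E] by auto
    obtain b where "b \<in> F v" "mdist X x b \<le> hausdorff_dist X (F u) (F v)"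
      using hausdorff_dist_nearest[OF F F x] uv by blast
    then show ?thesis
      using near[of v x] H[OF E] x FX uv by fastforce
  qed
  \<comment> \<open>The constant start \<open>x0\<close> is admissible because \<open>E 0\<close>
    has a single class, whose centre is \<open>u0\<close>.\<close>
  define g where "g = rec_nat (\<lambda>u. x0) (\<lambda>k h u. near (F (cen (Suc k) u)) (h u))"
  have g0: "g 0 u = x0" and gS: "g (Suc k) u = near (F (cen (Suc k) u)) (g k u)" for k u
    by (simp_all add: g_def)
  have g_in: "g k u \<in> F (cen k u)" if "u \<in> D" for k u
  proof (induction k)
    case 0
    have "(u, u0) \<in> E 0" using that u0 top by auto
    then show ?case using x0 by (simp add: g0 cen_def)
  next
    case (Suc k)
    then show ?case
      using near[OF cenD[OF that]] FX[OF cenD[OF that]] by (auto simp: gS)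
  qed
  have gX: "g k u \<in> mspace X" if "u \<in> D" for k u
    using g_in[OF that] FX[OF cenD[OF that]] by blast
  have g_step: "mdist X (g k u) (g (Suc k) u) \<le> L / 2 ^ k" if "u \<in> D" for k u
    unfolding gS
  proof (rule near_le)
    show "(cen k u, cen (Suc k) u) \<in> E k"
      by (rule trans[OF sym[OF cen[OF that]] subsetD[OF anti cen[OF that]]])
  qed (rule g_in[OF that])
  \<comment> \<open>Keeping the remainder \<open>2 * L / 2 ^ (k + m)\<close> closes the induction
    and leaves room for a final step of size \<open>L / 2 ^ N\<close> into
    \<open>F u\<close>.\<close>
  have g_tail: "mdist X (g k u) (g (k + m) u) \<le> 2 * L / 2 ^ k - 2 * L / 2 ^ (k + m)"
    if "u \<in> D" for k m u
  proof (induction m)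
    case 0
    then show ?case using gX[OF that] by simp
  next
    case (Suc m)
    have "mdist X (g k u) (g (k + Suc m) u)
        \<le> mdist X (g k u) (g (k + m) u) + mdist X (g (k + m) u) (g (k + Suc m) u)"
      using mdist_triangle[OF gX gX gX] that by blast
    also have "\<dots> \<le> 2 * L / 2 ^ k - 2 * L / 2 ^ (k + m) + L / 2 ^ (k + m)"
      using Suc g_step[OF that, of "k + m"] by simp
    finally show ?case by (simp add: field_simps)
  qed
  have g_cong: "g k u = g k v" if "(u, v) \<in> E k" for k u v
    using that
  proof (induction k)
    case (Suc k)
    then show ?case using anti[of k] cen_cong[OF Suc.prems] by (auto simp: gS)
  qed (simp add: g0)
  have g_u0: "g k u0 = x0" for k
  proof (induction k)
    case (Suc k)
    have "x0 \<in> mspace X" using FX[OF u0] x0 by blast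
    then have *: "near (F u0) x0 \<in> F u0" "mdist X x0 (near (F u0) x0) \<le> mdist X x0 x0"
      using near[OF u0, of x0] x0 by auto
    then have "mdist X x0 (near (F u0) x0) = 0"
      using \<open>x0 \<in> mspace X\<close> by (simp add: antisym)
    then have "near (F u0) x0 = x0"
      using * \<open>x0 \<in> mspace X\<close> FX[OF u0] by (auto simp: subset_iff)
    then show ?case by (simp add: gS cen_u0 Suc)
  qed (simp add: g0)
  have "\<exists>y. y \<in> F u \<and> (u = u0 \<longrightarrow> y = x0) \<and> (\<forall>k. mdist X (g k u) y \<le> 2 * L / 2 ^ k)"
    if u: "u \<in> D" for u
  proof (cases "u = u0")
    case True
    then show ?thesis
      using x0 g_u0 FX[OF u0] L by (intro exI[of _ x0]) auto
  next
    case False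
    \<comment> \<open>Any finitely many of these balls meet inside \<open>F u\<close>, hence all of
      them do; the common point plays the role of the limit.\<close>
    define B where "B k = mcball_of X (g k u) (2 * L / 2 ^ k)" for k
    have closed: "closedin (mtopology_of X) (B k)" for k
      unfolding B_def mcball_of_def mtopology_of_def
      using Metric_space.closedin_mcball[OF Metric_space_mspace_mdist] .
    have "F u \<inter> \<Inter>\<F> \<noteq> {}" if fin: "finite \<F>" and sub: "\<F> \<subseteq> range B" for \<F>
    proof -
      obtain I where I: "finite I" "\<F> = B ` I"
        using finite_subset_image[OF fin sub] by metis
      obtain N where N: "\<And>k. k \<in> I \<Longrightarrow> k \<le> N"
        using I(1) unfolding finite_nat_set_iff_bounded_le by blast
      \<comment> \<open>\<open>N\<close> bounds the finitely many indices, and the point of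
        \<open>F u\<close> nearest to the finest approximation lies in every ball concerned.\<close>
      let ?y = "near (F u) (g N u)"
      have y: "?y \<in> F u" using near[OF u gX[OF u]] by blast
      have yN: "mdist X (g N u) ?y \<le> L / 2 ^ N"
        using near_le[OF sym[OF cen[OF u]] g_in[OF u]] .
      have "?y \<in> B k" if kI: "k \<in> I" for k
      proof -
        obtain m where m: "N = k + m" using N[OF kI] le_iff_add by metis
        have "mdist X (g k u) ?y \<le> mdist X (g k u) (g N u) + mdist X (g N u) ?y"
          using mdist_triangle[OF gX gX] u y FX[OF u] by blast
        also have "\<dots> \<le> 2 * L / 2 ^ k - 2 * L / 2 ^ N + L / 2 ^ N"
          using g_tail[OF u, of k m] yN m by simp
        also have "\<dots> \<le> 2 * L / 2 ^ k" using L by (simp add: field_simps)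
        finally show ?thesis
          using gX[OF u] y FX[OF u] by (auto simp: B_def)
      qed
      then show ?thesis using y I(2) by blast
    qed
    then have "F u \<inter> \<Inter>(range B) \<noteq> {}"
      using F[OF u, unfolded nonempty_compacts_def compactin_fip mem_Collect_eq] closed
      by (metis (no_types, lifting) rangeE)
    then obtain y where "y \<in> F u" "\<And>k. y \<in> B k" by blast
    then show ?thesis using False by (auto simp: B_def)
  qed
  then obtain f where f: "\<And>u. u \<in> D \<Longrightarrow> f u \<in> F u \<and> (u = u0 \<longrightarrow> f u = x0) \<and>
      (\<forall>k. mdist X (g k u) (f u) \<le> 2 * L / 2 ^ k)"
    by metis
  show ?thesis
  proof
    show "f u \<in> F u" if "u \<in> D" for u using f[OF that] by blast
    show "f u0 = x0" using f[OF u0] by blast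
    show "mdist X (f u) (f v) \<le> 4 * L / 2 ^ k" if "(u, v) \<in> E k" for k u v
    proof -
      have uv: "u \<in> D" "v \<in> D" using ED that by auto
      have "mdist X (f u) (f v) \<le> mdist X (f u) (g k u) + mdist X (g k u) (f v)"
        using mdist_triangle gX f FX uv by (meson subsetD)
      also have "\<dots> \<le> 2 * L / 2 ^ k + 2 * L / 2 ^ k"
        using f uv g_cong[OF that] by (metis add_mono mdist_commute)
      finally show ?thesis by simp
    qed
  qed
qed

text \<open>The finest dyadic scale still dominating \<open>t\<close>. The factor 2 lost here turns
  the 4 of \<open>nested_partition_selection\<close> into the 8 of the final constant.\<close>

lemma dyadic_scale:
  fixes t R :: real
  assumes "0 < t" "t \<le> R"
  obtains k where "t \<le> R / 2 ^ k" "R / 2 ^ k < 2 * t"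
proof -
  obtain n where n: "R / t < 2 ^ n"
    using real_arch_pow[of 2 "R / t"] by auto
  define m where "m = (LEAST m. R / t < 2 ^ m)"
  have m: "R / t < 2 ^ m" unfolding m_def using n by (rule LeastI)
  have "m \<noteq> 0"
    using m assms by (cases "m = 0") (auto simp: divide_less_eq)
  then obtain k where k: "m = Suc k" using not0_implies_Suc by blast
  have "\<not> R / t < 2 ^ k"
    using not_less_Least[of k "\<lambda>m. R / t < 2 ^ m"] k by (simp add: m_def)
  then show ?thesis
    using that[of k] m assms k by (simp add: field_simps)
qed

text \<open>A path in the closure is a chain in \<open>D\<close>, so its longest step is at least
  \<open>c * \<bar>u - v\<bar>\<close>, while the \<open>\<alpha>\<close>-th power of every step is
  at most \<open>r\<close>.\<close>

lemma chain_of_rtrancl_step_bound: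
  assumes D: "c_uniformly_disconnected c D" and "0 < c" "0 < \<alpha>"
    and uv: "u \<in> D" "v \<in> D" "u \<noteq> v"
    and chain: "(u, v) \<in> {(a, b). a \<in> D \<and> b \<in> D \<and> \<bar>a - b\<bar> powr \<alpha> \<le> r}\<^sup>*"
  shows "c powr \<alpha> * \<bar>u - v\<bar> powr \<alpha> \<le> r"
proof -
  let ?S = "{(a, b). a \<in> D \<and> b \<in> D \<and> \<bar>a - b\<bar> powr \<alpha> \<le> r}"
  obtain N w where w: "w 0 = u" "w N = v" "\<And>i. i < N \<Longrightarrow> (w i, w (Suc i)) \<in> ?S"
    using chain by (auto simp: rtrancl_is_UN_relpow relpow_fun_conv)
  have "w i \<in> D" if "i \<le> N" for i
    using w(2) w(3)[of i] uv that by (cases "i = N") auto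
  then have "c * \<bar>u - v\<bar> \<le> (MAX i\<in>{1..N}. \<bar>w i - w (i - 1)\<bar>)"
    using D uv w(1,2) unfolding c_uniformly_disconnected_def by blast
  moreover have "{1..N} \<noteq> {}"
    using w(1,2) uv by (cases N) auto
  ultimately obtain i where i: "i \<in> {1..N}" "c * \<bar>u - v\<bar> \<le> \<bar>w i - w (i - 1)\<bar>"
    by (auto simp: Max_ge_iff)
  have "c powr \<alpha> * \<bar>u - v\<bar> powr \<alpha> = (c * \<bar>u - v\<bar>) powr \<alpha>"
    using \<open>0 < c\<close> by (simp add: powr_mult)
  also have "\<dots> \<le> \<bar>w i - w (i - 1)\<bar> powr \<alpha>"
    using i assms by (intro powr_mono2) auto
  also have "\<dots> \<le> r"
    using w(3)[of "i - 1"] i(1) by (auto simp: abs_minus_commute)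
  finally show ?thesis .
qed

text \<open>Scales are measured by \<open>\<bar>u - v\<bar> powr \<alpha>\<close>, so halving the
  scale halves the variation of \<open>F\<close> and the geometric series has ratio
  \<open>1 / 2\<close> for every \<open>\<alpha>\<close>.\<close>

lemma pointed_holder_selections_if_disconnected:
  assumes "0 < \<alpha>" "bounded D" "0 < c" and D: "c_uniformly_disconnected c D"
  shows "pointed_holder_selections \<alpha> D (8 * c powr (- \<alpha>)) X"
  unfolding pointed_holder_selections_def
proof (intro allI ballI impI)
  fix F u0 x0
  assume F: "holder_setmap \<alpha> D X F" and u0: "u0 \<in> D" and x0: "x0 \<in> F u0"
  define H where "H = holder_const \<alpha> D (hausdorff_dist X) F"
  have "holder_bound \<alpha> D (hausdorff_dist X) F H"
    using F holder_const_least(1) unfolding H_def holder_setmap_def by blast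
  then have H: "0 \<le> H" "\<And>u v. u \<in> D \<Longrightarrow> v \<in> D \<Longrightarrow>
      hausdorff_dist X (F u) (F v) \<le> H * \<bar>u - v\<bar> powr \<alpha>"
    by (auto simp: holder_bound_def)
  obtain B where B: "\<And>u. u \<in> D \<Longrightarrow> \<bar>u\<bar> \<le> B"
    using \<open>bounded D\<close> by (auto simp: bounded_iff)
  \<comment> \<open>At scale \<open>R\<close> any two points of \<open>D\<close> are one step apart,
    so \<open>E 0\<close> is a single class.\<close>
  define R where "R = (2 * \<bar>B\<bar>) powr \<alpha>"
  have R: "\<bar>u - v\<bar> powr \<alpha> \<le> R" if "u \<in> D" "v \<in> D" for u v
    unfolding R_def using B[OF that(1)] B[OF that(2)] \<open>0 < \<alpha>\<close> by (intro powr_mono2) auto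
  define S where "S k = {(a, b). a \<in> D \<and> b \<in> D \<and> \<bar>a - b\<bar> powr \<alpha> \<le> R / 2 ^ k}" for k :: nat
  \<comment> \<open>The reflexive closure also relates points outside \<open>D\<close> to
    themselves; the intersection removes these pairs, as \<open>equiv D\<close> demands.\<close>
  define E where "E k = (S k)\<^sup>* \<inter> D \<times> D" for k
  define L where "L = H * c powr (- \<alpha>) * R"
  have SE: "S k \<subseteq> E k" for k
    by (auto simp: E_def S_def)
  have near: "hausdorff_dist X (F u) (F v) \<le> L / 2 ^ k" if "(u, v) \<in> E k" for u v k
  proof -
    have uv: "u \<in> D" "v \<in> D" "(u, v) \<in> (S k)\<^sup>*" using that by (auto simp: E_def)
    have "c powr \<alpha> * \<bar>u - v\<bar> powr \<alpha> \<le> R / 2 ^ k"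
    proof (cases "u = v")
      case False
      then show ?thesis
        using chain_of_rtrancl_step_bound[OF D \<open>0 < c\<close> \<open>0 < \<alpha>\<close> uv(1,2)] uv(3) by (simp add: S_def)
    qed (simp add: R_def)
    then have "\<bar>u - v\<bar> powr \<alpha> \<le> c powr (- \<alpha>) * R / 2 ^ k"
      using \<open>0 < c\<close> by (simp add: powr_minus field_simps)
    then have "H * \<bar>u - v\<bar> powr \<alpha> \<le> H * (c powr (- \<alpha>) * R / 2 ^ k)"
      using H(1) by (rule mult_left_mono)
    then show ?thesis
      using H(2)[OF uv(1,2)] by (simp add: L_def mult.assoc)
  qed
  have equiv: "equiv D (E k)" for k
  proof (rule equivI)
    have "sym ((S k)\<^sup>*)"
      by (rule sym_rtrancl) (auto simp: sym_def S_def abs_minus_commute)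
    then show "sym (E k)" by (auto simp: E_def sym_def)
    show "trans (E k)" unfolding E_def trans_def by (blast intro: rtrancl_trans)
    show "E k \<subseteq> D \<times> D" by (auto simp: E_def)
    show "refl_on D (E k)" by (auto simp: E_def refl_on_def)
  qed
  have top: "E 0 = D \<times> D"
    using SE[of 0] R by (auto simp: E_def S_def)
  have anti: "E (Suc k) \<subseteq> E k" for k
  proof -
    have "R / 2 ^ Suc k \<le> R / 2 ^ k" by (simp add: R_def field_simps)
    then have "S (Suc k) \<subseteq> S k" by (auto simp: S_def)
    then show ?thesis unfolding E_def using rtrancl_mono by blast
  qed
  have "0 \<le> L" using H(1) by (simp add: L_def R_def)
  moreover have "F u \<in> nonempty_compacts X" if "u \<in> D" for u
    using F that by (auto simp: holder_setmap_def)
  ultimately obtain f where f: "\<And>u. u \<in> D \<Longrightarrow> f u \<in> F u" "f u0 = x0"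
    "\<And>k u v. (u, v) \<in> E k \<Longrightarrow> mdist X (f u) (f v) \<le> 4 * L / 2 ^ k"
    using nested_partition_selection[where E = E and F = F and X = X and D = D, OF equiv top anti _ near _ u0 x0]
    by blast
  have bound: "holder_bound \<alpha> D (mdist X) f (8 * c powr (- \<alpha>) * H)"
    unfolding holder_bound_def
  proof (intro conjI ballI)
    show "0 \<le> 8 * c powr (- \<alpha>) * H" using H(1) by simp
    fix u v assume uv: "u \<in> D" "v \<in> D"
    show "mdist X (f u) (f v) \<le> 8 * c powr (- \<alpha>) * H * \<bar>u - v\<bar> powr \<alpha>"
    proof (cases "u = v")
      case True
      have "f u \<in> mspace X"
        using f(1)[OF uv(1)] F uv(1) nonempty_compacts_subset_mspace
        by (fastforce simp: holder_setmap_def)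
      then show ?thesis using True by simp
    next
      case False
      then have "0 < \<bar>u - v\<bar> powr \<alpha>" by simp
      then obtain k where k: "\<bar>u - v\<bar> powr \<alpha> \<le> R / 2 ^ k" "R / 2 ^ k < 2 * \<bar>u - v\<bar> powr \<alpha>"
        using dyadic_scale R[OF uv] by blast
      have "(u, v) \<in> E k" using k(1) uv SE by (auto simp: S_def)
      then have "mdist X (f u) (f v) \<le> 4 * H * c powr (- \<alpha>) * (R / 2 ^ k)"
        using f(3)[of u v k] by (simp add: L_def mult.assoc)
      also have "\<dots> \<le> 4 * H * c powr (- \<alpha>) * (2 * \<bar>u - v\<bar> powr \<alpha>)"
        using k(2) H(1) by (intro mult_left_mono) auto
      finally show ?thesis by (simp add: mult_ac)
    qed
  qed
  then have "holder_on \<alpha> D (mdist X) f" by (auto simp: holder_on_def)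
  with bound f holder_const_least(2)
  show "\<exists>f. selection_on D F f \<and> f u0 = x0 \<and> holder_on \<alpha> D (mdist X) f \<and>
      holder_const \<alpha> D (mdist X) f
        \<le> 8 * c powr (- \<alpha>) * holder_const \<alpha> D (hausdorff_dist X) F"
    unfolding H_def[symmetric] selection_on_def by blast
qed

section \<open>Rotating gaps along thin chains\<close>

text \<open>Failure of disconnectedness gives a chain of uncontrolled length \<open>l\<close>. It is
  cut where it first reaches distance \<open>m = min l (r / 2)\<close> from its start; its steps are
  so short that they stay small relative to \<open>m\<close>.\<close>

lemma thin_chain_at_small_scale:
  assumes D: "\<not> uniformly_disconnected D" "bounded D" and "0 < c" "0 < r"
  obtains N and w :: "nat \<Rightarrow> real" where
    "\<And>i. i \<le> N \<Longrightarrow> w i \<in> D" "0 < \<bar>w N - w 0\<bar>" "\<bar>w N - w 0\<bar> \<le> r"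
    "\<And>i. i < N \<Longrightarrow> \<bar>w (Suc i) - w i\<bar> < c * \<bar>w N - w 0\<bar>"
    "\<And>i. i \<le> N \<Longrightarrow> \<bar>w i - w 0\<bar> \<le> \<bar>w N - w 0\<bar>"
proof -
  obtain M where M: "0 < M" "\<And>u. u \<in> D \<Longrightarrow> \<bar>u\<bar> \<le> M"
    using \<open>bounded D\<close> unfolding bounded_pos by auto
  define B where "B = 2 * M"
  have B: "\<bar>u - v\<bar> \<le> B" if "u \<in> D" "v \<in> D" for u v
    using M(2)[OF that(1)] M(2)[OF that(2)] by (auto simp: B_def)
  have "0 < B" using M(1) by (simp add: B_def)
  \<comment> \<open>The entry \<open>r / (2 * B)\<close> limits the overshoot of the last step to
    \<open>r / 2\<close>; the entries \<open>c\<close> and \<open>c * r / (2 * B)\<close> make steps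
    shorter than \<open>c * m\<close> in the two cases of \<open>m\<close>.\<close>
  define c' where "c' = Min {1, c, r / (2 * B), c * r / (2 * B)}"
  have c': "0 < c'" "c' \<le> 1" "c' \<le> c" "c' \<le> r / (2 * B)" "c' \<le> c * r / (2 * B)"
    using assms(3,4) \<open>0 < B\<close> by (auto simp: c'_def)
  have "\<not> c_uniformly_disconnected c' D"
    using D(1) c'(1,2) by (auto simp: uniformly_disconnected_def)
  then obtain N and w :: "nat \<Rightarrow> real" where w: "w 0 \<noteq> w N" "\<forall>i\<le>N. w i \<in> D"
      and max: "(MAX i\<in>{1..N}. \<bar>w i - w (i - 1)\<bar>) < c' * \<bar>w 0 - w N\<bar>"
    unfolding c_uniformly_disconnected_def not_le[symmetric] by metis
  define l where "l = \<bar>w N - w 0\<bar>"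
  have "0 < l" using w(1) by (simp add: l_def)
  have step: "\<bar>w (Suc i) - w i\<bar> < c' * l" if "i < N" for i
  proof -
    have "\<bar>w (Suc i) - w (Suc i - 1)\<bar> \<le> (MAX i\<in>{1..N}. \<bar>w i - w (i - 1)\<bar>)"
      using that by (intro Max_ge imageI[of "Suc i"]) auto
    then show ?thesis using max by (simp add: l_def abs_minus_commute)
  qed
  have "l \<le> B" using B w(2) by (simp add: l_def)
  then have "c' * l \<le> c' * B" using c'(1) by simp
  moreover have "c' * B \<le> r / 2" "c' * B \<le> c * r / 2"
    using c'(4,5) \<open>0 < B\<close> by (auto simp: field_simps)
  moreover have "c' * l \<le> c * l" using c'(3) \<open>0 < l\<close> by simp
  ultimately have c'l: "c' * l \<le> r / 2" "c' * l \<le> c * min l (r / 2)"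
    by (auto simp: min_def)
  define m where "m = min l (r / 2)"
  have "0 < m" using \<open>0 < l\<close> assms(4) by (simp add: m_def)
  define j where "j = (LEAST j. m \<le> \<bar>w j - w 0\<bar>)"
  have "m \<le> \<bar>w N - w 0\<bar>" by (simp add: m_def l_def)
  then have j: "m \<le> \<bar>w j - w 0\<bar>" "j \<le> N"
    unfolding j_def by (rule LeastI, rule Least_le)
  have before: "\<bar>w i - w 0\<bar> < m" if "i < j" for i
    using not_less_Least[of i "\<lambda>j. m \<le> \<bar>w j - w 0\<bar>"] that by (simp add: j_def)
  have "j \<noteq> 0" using j(1) \<open>0 < m\<close> by (cases "j = 0") auto
  then obtain i where i: "j = Suc i" using not0_implies_Suc by blast
  have "c * m \<le> c * \<bar>w j - w 0\<bar>" using j(1) assms(3) by simp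
  then show ?thesis
  proof (intro that[of j w])
    show "w i \<in> D" if "i \<le> j" for i using w(2) j(2) that by simp
    show "0 < \<bar>w j - w 0\<bar>" using j(1) \<open>0 < m\<close> by simp
    have "m \<le> r / 2" by (simp add: m_def)
    then show "\<bar>w j - w 0\<bar> \<le> r"
      using before[of i] step[of i] c'l(1) i j(2) by auto
    show "\<bar>w (Suc i) - w i\<bar> < c * \<bar>w j - w 0\<bar>" if "i < j" for i
      using step[of i] c'l(2) \<open>c * m \<le> _\<close> that j(2) by (simp add: m_def)
    show "\<bar>w i - w 0\<bar> \<le> \<bar>w j - w 0\<bar>" if "i \<le> j" for i
      using before[of i] j(1) that by (cases "i = j") auto
  qed
qed

section \<open>Chords, arcs and circles with a gap\<close>

lemma abs_mult_diff: "0 \<le> k \<Longrightarrow> \<bar>k * a - k * b\<bar> = k * \<bar>a - b\<bar>" for a b k :: real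
  by (simp add: abs_mult flip: right_diff_distrib)

text \<open>The gap is the open arc of half-angle \<open>g\<close> around the direction \<open>\<theta>\<close>.\<close>

definition gapped_circle :: "real \<Rightarrow> real \<Rightarrow> real \<Rightarrow> complex set" where
  "gapped_circle r g \<theta> = (\<lambda>\<psi>. of_real r * cis (\<theta> + \<psi>)) ` {g..2 * pi - g}"

lemma dist_cis: "dist (cis a) (cis b) = 2 * \<bar>sin ((a - b) / 2)\<bar>"
proof -
  have "(cmod (cis a - cis b))\<^sup>2 = 2 - 2 * cos (a - b)"
    using sin_cos_squared_add[of a] sin_cos_squared_add[of b]
    unfolding cmod_power2 by (simp add: cos_diff power2_eq_square algebra_simps)
  also have "\<dots> = (2 * \<bar>sin ((a - b) / 2)\<bar>)\<^sup>2"
  proof -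
    have "a - b = 2 * ((a - b) / 2)" by simp
    then have "cos (a - b) = 1 - 2 * (sin ((a - b) / 2))\<^sup>2"
      by (metis cos_double_sin)
    then show ?thesis by (simp add: power_mult_distrib)
  qed
  finally show ?thesis
    unfolding dist_norm by (rule power2_eq_imp_eq) auto
qed

lemma dist_circle:
  "0 \<le> r \<Longrightarrow> dist (of_real r * cis a) (of_real r * cis b) = 2 * r * \<bar>sin ((a - b) / 2)\<bar>"
  using dist_cis[of a b]
  by (simp add: dist_norm norm_mult flip: right_diff_distrib)

lemma dist_circle_le:
  assumes "0 \<le> r"
  shows "dist (of_real r * cis a) (of_real r * cis b) \<le> r * \<bar>a - b\<bar>"
proof -
  have "2 * r * \<bar>sin ((a - b) / 2)\<bar> \<le> 2 * r * \<bar>(a - b) / 2\<bar>"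
    using assms abs_sin_x_le_abs_x by (intro mult_left_mono) (auto simp del: abs_divide)
  then show ?thesis
    using assms by (simp add: dist_circle)
qed

text \<open>Chords grow up to the antipode and then shrink symmetrically. The upper bound on the
  angle matters because angles are not reduced modulo \<open>2 * pi\<close>.\<close>

lemma dist_circle_ge:
  assumes "0 \<le> r" "0 \<le> \<beta>" "\<beta> \<le> \<bar>a - b\<bar>" "\<bar>a - b\<bar> \<le> 2 * pi - \<beta>"
  shows "2 * r * sin (\<beta> / 2) \<le> dist (of_real r * cis a) (of_real r * cis b)"
proof -
  define x where "x = \<bar>a - b\<bar> / 2"
  have x: "\<beta> / 2 \<le> x" "x \<le> pi - \<beta> / 2" using assms by (auto simp: x_def)
  have "sin (\<beta> / 2) \<le> sin x"
  proof (cases "x \<le> pi / 2")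
    case True
    then show ?thesis using x assms by (subst sin_mono_le_eq) auto
  next
    case False
    have "sin (\<beta> / 2) \<le> sin (pi - x)"
      using False x assms by (subst sin_mono_le_eq) auto
    then show ?thesis by simp
  qed
  also have "\<dots> \<le> \<bar>sin ((a - b) / 2)\<bar>"
  proof -
    define y where "y = (a - b) / 2"
    have "x = y \<or> x = - y" by (simp add: x_def y_def abs_if field_simps)
    then show ?thesis unfolding y_def[symmetric] by auto
  qed
  finally have "2 * r * sin (\<beta> / 2) \<le> 2 * r * \<bar>sin ((a - b) / 2)\<bar>"
    using assms(1) by (simp add: mult_left_mono)
  then show ?thesis using assms(1) by (simp add: dist_circle)
qed

text \<open>The angle is reduced modulo \<open>2 * pi\<close> relative to \<open>\<theta>\<close>
  and clamped to the arc; a direction inside the gap is within \<open>g\<close> of one of its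
  ends.\<close>

lemma gapped_circle_fills_gap:
  assumes "0 \<le> r" "0 \<le> g" "g \<le> pi"
  shows "\<exists>y\<in>gapped_circle r g \<theta>. dist (of_real r * cis a) y \<le> r * g"
proof -
  define k where "k = \<lfloor>(a - \<theta>) / (2 * pi)\<rfloor>"
  define \<psi> where "\<psi> = a - \<theta> - 2 * pi * of_int k"
  have \<psi>: "0 \<le> \<psi>" "\<psi> \<le> 2 * pi"
  proof -
    have "of_int k \<le> (a - \<theta>) / (2 * pi)" "(a - \<theta>) / (2 * pi) \<le> of_int k + 1"
      unfolding k_def by linarith+
    then show "0 \<le> \<psi>" "\<psi> \<le> 2 * pi" by (auto simp: \<psi>_def field_simps)
  qed
  define \<psi>' where "\<psi>' = max g (min \<psi> (2 * pi - g))"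
  have \<psi>': "\<psi>' \<in> {g..2 * pi - g}" "\<bar>\<psi> - \<psi>'\<bar> \<le> g"
    using \<psi> assms by (auto simp: \<psi>'_def)
  have "cis (2 * pi * of_int k) = 1"
    by (rule cis_multiple_2pi) auto
  then have "cis a = cis (\<theta> + \<psi>)"
    by (simp add: \<psi>_def flip: cis_divide)
  then have "dist (of_real r * cis a) (of_real r * cis (\<theta> + \<psi>')) \<le> r * \<bar>(\<theta> + \<psi>) - (\<theta> + \<psi>')\<bar>"
    using dist_circle_le[OF assms(1), of "\<theta> + \<psi>" "\<theta> + \<psi>'"] by simp
  also have "\<dots> \<le> r * g"
    using \<psi>'(2) assms(1) by (intro mult_left_mono) auto
  finally show ?thesis
    using \<psi>'(1) by (auto simp: gapped_circle_def)
qed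

lemma gapped_circle_rotate:
  assumes "0 \<le> r" "x \<in> gapped_circle r g \<theta>"
  shows "\<exists>y\<in>gapped_circle r g \<theta>'. dist x y \<le> r * \<bar>\<theta> - \<theta>'\<bar>"
proof -
  obtain \<psi> where \<psi>: "\<psi> \<in> {g..2 * pi - g}" "x = of_real r * cis (\<theta> + \<psi>)"
    using assms(2) by (auto simp: gapped_circle_def)
  then show ?thesis
    using dist_circle_le[OF assms(1), of "\<theta> + \<psi>" "\<theta>' + \<psi>"]
    by (intro bexI[of _ "of_real r * cis (\<theta>' + \<psi>)"]) (auto simp: gapped_circle_def)
qed

text \<open>
  Rotating moves every point by at most the angle, and filling the gap costs at most \<open>g\<close>; the
  bound interpolates between the two estimates.
\<close>

lemma gapped_circle_near:
  assumes "0 \<le> r" "0 \<le> g" "g \<le> pi" "0 < \<alpha>" "\<alpha> < 1" "x \<in> gapped_circle r g \<theta>"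
  shows "\<exists>y\<in>gapped_circle r g \<theta>'. dist x y \<le> r * g powr (1 - \<alpha>) * \<bar>\<theta> - \<theta>'\<bar> powr \<alpha>"
proof (cases "\<bar>\<theta> - \<theta>'\<bar> \<le> g")
  case True
  define t where "t = \<bar>\<theta> - \<theta>'\<bar>"
  have "t = t powr (1 - \<alpha>) * t powr \<alpha>"
    by (cases "t = 0") (auto simp: t_def simp flip: powr_add)
  also have "\<dots> \<le> g powr (1 - \<alpha>) * t powr \<alpha>"
    using True assms by (intro mult_right_mono powr_mono2) (auto simp: t_def)
  finally have "r * t \<le> r * g powr (1 - \<alpha>) * t powr \<alpha>"
    using assms(1) by (simp add: mult.assoc mult_left_mono)
  then show ?thesis
    using gapped_circle_rotate[OF assms(1,6), of \<theta>'] unfolding t_def by (meson order_trans)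
next
  case False
  have "g = g powr (1 - \<alpha>) * g powr \<alpha>"
    using assms by (cases "g = 0") (auto simp flip: powr_add)
  also have "\<dots> \<le> g powr (1 - \<alpha>) * \<bar>\<theta> - \<theta>'\<bar> powr \<alpha>"
    using False assms by (intro mult_left_mono powr_mono2) auto
  finally have "r * g \<le> r * g powr (1 - \<alpha>) * \<bar>\<theta> - \<theta>'\<bar> powr \<alpha>"
    using assms(1) by (simp add: mult.assoc mult_left_mono)
  moreover obtain a where "x = of_real r * cis a"
    using assms(6) by (auto simp: gapped_circle_def)
  ultimately show ?thesis
    using gapped_circle_fills_gap[OF assms(1-3), of \<theta>' a] by (meson order_trans)
qed

lemma compact_gapped_circle: "compact (gapped_circle r g \<theta>)"
  unfolding gapped_circle_def cis_conv_exp
  by (intro compact_continuous_image continuous_intros compact_Icc)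

text \<open>
  The gap turns twice along the chain and the steps are too short to jump over it, so the gap
  pushes any slow selection through a quarter turn.
\<close>

lemma gapped_circle_selection_fast:
  assumes chain: "\<And>i. i < N \<Longrightarrow> \<bar>w (Suc i) - w i\<bar> < c * l"
      "\<And>i. i \<le> N \<Longrightarrow> \<bar>w i - w 0\<bar> \<le> l" "\<bar>w N - w 0\<bar> = l" "0 < l"
    and c: "0 < c" "4 * pi * c \<le> g" "c powr \<alpha> \<le> sin (g / 2)"
    and g: "0 < g" "g < pi / 2" and "0 < \<alpha>" "0 < A"
    and f: "\<And>i. i \<le> N \<Longrightarrow> f (w i) \<in> gapped_circle (A * l powr \<alpha>) g (4 * pi / l * w i)"
  shows "\<exists>i\<le>N. \<exists>j\<le>N. A * \<bar>w i - w j\<bar> powr \<alpha> < dist (f (w i)) (f (w j))"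
proof (rule ccontr)
  assume "\<not> ?thesis"
  then have slow: "dist (f (w i)) (f (w j)) \<le> A * \<bar>w i - w j\<bar> powr \<alpha>" if "i \<le> N" "j \<le> N" for i j
    using that by (auto simp: not_less)
  define r where "r = A * l powr \<alpha>"
  have "0 < r" using \<open>0 < A\<close> \<open>0 < l\<close> by (simp add: r_def)
  have "\<forall>i. \<exists>\<psi>. i \<le> N \<longrightarrow> \<psi> \<in> {g..2 * pi - g} \<and> f (w i) = of_real r * cis (4 * pi / l * w i + \<psi>)"
    using f unfolding gapped_circle_def r_def by blast
  then obtain \<psi> where \<psi>: "\<And>i. i \<le> N \<Longrightarrow> g \<le> \<psi> i" "\<And>i. i \<le> N \<Longrightarrow> \<psi> i \<le> 2 * pi - g"
      "\<And>i. i \<le> N \<Longrightarrow> f (w i) = of_real r * cis (4 * pi / l * w i + \<psi> i)"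
    unfolding choice_iff atLeastAtMost_iff by blast
  \<comment> \<open>A real lift of the angle of the selected point: the direction of the gap plus
    the offset from it.\<close>
  define \<phi> where "\<phi> i = 4 * pi / l * w i + \<psi> i" for i
  have jump: "2 * r * sin (\<beta> / 2) \<le> A * \<bar>w i - w j\<bar> powr \<alpha>"
    if "i \<le> N" "j \<le> N" "0 \<le> \<beta>" "\<beta> \<le> \<bar>\<phi> i - \<phi> j\<bar>" "\<bar>\<phi> i - \<phi> j\<bar> \<le> 2 * pi - \<beta>" for i j \<beta>
    using dist_circle_ge[of r \<beta> "\<phi> i" "\<phi> j"] slow[of i j] that \<open>0 < r\<close> by (simp add: \<psi>(3) \<phi>_def)
  \<comment> \<open>Offsets differ by at most \<open>2 * pi - 2 * g\<close> and the gap turns by at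
    most \<open>g\<close>, so the lift cannot come close to a full turn. A change of at least
    \<open>g\<close> would then force a chord longer than the slow selection allows.\<close>
  have step: "\<bar>\<phi> (Suc i) - \<phi> i\<bar> < g" if "i < N" for i
  proof (rule ccontr)
    assume *: "\<not> ?thesis"
    have "\<bar>4 * pi / l * w (Suc i) - 4 * pi / l * w i\<bar> = 4 * pi / l * \<bar>w (Suc i) - w i\<bar>"
      using \<open>0 < l\<close> by (intro abs_mult_diff) simp
    also have "\<dots> \<le> 4 * pi / l * (c * l)"
      using chain(1)[OF that] \<open>0 < l\<close> by (intro mult_left_mono) auto
    also have "\<dots> \<le> g" using c(2) \<open>0 < l\<close> by simp
    finally have "\<bar>\<phi> (Suc i) - \<phi> i\<bar> \<le> 2 * pi - g"
      using \<psi>(1,2)[of i] \<psi>(1,2)[of "Suc i"] that by (simp add: \<phi>_def abs_le_iff)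
    then have "2 * r * sin (g / 2) \<le> A * \<bar>w (Suc i) - w i\<bar> powr \<alpha>"
      using jump[of "Suc i" i g] * that g(1) by simp
    also have "\<dots> \<le> A * (c * l) powr \<alpha>"
      using chain(1)[OF that] \<open>0 < A\<close> \<open>0 < \<alpha>\<close> by (intro mult_left_mono powr_mono2) auto
    also have "\<dots> = r * c powr \<alpha>"
      using c(1) \<open>0 < l\<close> by (simp add: r_def powr_mult)
    also have "\<dots> \<le> r * sin (g / 2)"
      using c(3) \<open>0 < r\<close> by simp
    finally have "sin (g / 2) \<le> 0" using \<open>0 < r\<close> by simp
    moreover have "0 < sin (g / 2)" using g by (intro sin_gt_zero) auto
    ultimately show False by simp
  qed
  have "\<bar>4 * pi / l * w N - 4 * pi / l * w 0\<bar> = 4 * pi"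
    using abs_mult_diff[of "4 * pi / l" "w N" "w 0"] chain(3,4) by simp
  \<comment> \<open>Two turns contribute \<open>4 * pi\<close>, of which the offsets can undo less
    than \<open>2 * pi\<close>.\<close>
  then have "pi / 2 \<le> \<bar>\<phi> N - \<phi> 0\<bar>"
    using \<psi>(1,2)[of 0] \<psi>(1,2)[of N] g pi_gt_zero by (simp add: \<phi>_def abs_if split: if_splits)
  define j where "j = (LEAST j. pi / 2 \<le> \<bar>\<phi> j - \<phi> 0\<bar>)"
  have j: "pi / 2 \<le> \<bar>\<phi> j - \<phi> 0\<bar>" "j \<le> N"
    unfolding j_def by (rule LeastI Least_le, fact)+
  have "j \<noteq> 0" using j(1) pi_gt_zero by (cases "j = 0") auto
  then obtain i where i: "j = Suc i" using not0_implies_Suc by blast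
  have "\<bar>\<phi> i - \<phi> 0\<bar> < pi / 2"
    using not_less_Least[of i "\<lambda>j. pi / 2 \<le> \<bar>\<phi> j - \<phi> 0\<bar>"] i by (simp add: j_def)
  \<comment> \<open>At the first passage beyond a quarter turn the lift has not wrapped around, so
    the chord is at least \<open>sqrt 2 * r\<close>, whereas slowness allows only
    \<open>r\<close>.\<close>
  then have "\<bar>\<phi> j - \<phi> 0\<bar> \<le> 2 * pi - pi / 2"
    using step[of i] i j(2) g by (simp add: abs_if split: if_splits)
  then have "2 * r * sin (pi / 2 / 2) \<le> A * \<bar>w j - w 0\<bar> powr \<alpha>"
    using jump[of j 0 "pi / 2"] j by simp
  also have "\<dots> \<le> r"
    unfolding r_def using chain(2)[OF j(2)] \<open>0 < A\<close> \<open>0 < \<alpha>\<close>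
    by (intro mult_left_mono powr_mono2) auto
  finally have "sqrt 2 \<le> 1"
    using \<open>0 < r\<close> by (simp add: sin_45)
  then show False by simp
qed

text \<open>Radius \<open>A * l powr \<alpha>\<close> and angular speed \<open>4 * pi / l\<close>
  give a Hoelder constant in which \<open>l\<close> cancels. Hence \<open>g\<close> is fixed from
  \<open>A\<close>, then \<open>c\<close> from \<open>g\<close>, before the chain is chosen.\<close>

lemma exists_fast_selections_only:
  assumes D: "\<not> uniformly_disconnected D" "bounded D" and \<alpha>: "0 < \<alpha>" "\<alpha> < 1" and "0 < A"
  shows "\<exists>F :: real \<Rightarrow> complex set. (\<forall>u. compact (F u) \<and> F u \<noteq> {} \<and> F u \<subseteq> cball 0 (1 / 2)) \<and>
    (\<forall>s t. \<forall>x\<in>F s. \<exists>y\<in>F t. dist x y \<le> \<bar>s - t\<bar> powr \<alpha>) \<and>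
    (\<forall>f. (\<forall>u\<in>D. f u \<in> F u) \<longrightarrow> (\<exists>s\<in>D. \<exists>t\<in>D. A * \<bar>s - t\<bar> powr \<alpha> < dist (f s) (f t)))"
proof -
  \<comment> \<open>The second entry makes the Hoelder constant at most 1; its exponent is where
    \<open>\<alpha> < 1\<close> enters. The cap 1 keeps \<open>g\<close> below
    \<open>pi / 2\<close>.\<close>
  define g where "g = min 1 ((1 / (A * (4 * pi) powr \<alpha>)) powr (1 / (1 - \<alpha>)))"
  have g: "0 < g" "g \<le> 1" "g < pi / 2"
    using \<open>0 < A\<close> pi_gt3 by (auto simp: g_def)
  have "g powr (1 - \<alpha>) \<le> ((1 / (A * (4 * pi) powr \<alpha>)) powr (1 / (1 - \<alpha>))) powr (1 - \<alpha>)"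
    using g(1) \<alpha> by (intro powr_mono2) (auto simp: g_def)
  also have "\<dots> = 1 / (A * (4 * pi) powr \<alpha>)"
    using \<alpha> \<open>0 < A\<close> by (simp add: powr_powr)
  finally have gA: "A * g powr (1 - \<alpha>) * (4 * pi) powr \<alpha> \<le> 1"
    using \<open>0 < A\<close> by (simp add: field_simps)
  have sin: "0 < sin (g / 2)" using g by (intro sin_gt_zero) auto
  define c where "c = min (g / (4 * pi)) (sin (g / 2) powr (1 / \<alpha>))"
  have c: "0 < c" "4 * pi * c \<le> g"
    using g(1) sin by (auto simp: c_def min_def field_simps)
  have "c powr \<alpha> \<le> (sin (g / 2) powr (1 / \<alpha>)) powr \<alpha>"
    using c(1) \<alpha> by (intro powr_mono2) (auto simp: c_def)
  then have c_sin: "c powr \<alpha> \<le> sin (g / 2)" using sin \<alpha> by (simp add: powr_powr)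
  \<comment> \<open>Chains of length at most \<open>R\<close> give radius at most
    \<open>1 / 2\<close>, so distances stay below the truncation at 1 in the product metric.\<close>
  define R where "R = (1 / (2 * A)) powr (1 / \<alpha>)"
  have "0 < R" using \<open>0 < A\<close> by (simp add: R_def)
  obtain N w where w: "\<And>i. i \<le> N \<Longrightarrow> w i \<in> D" "0 < \<bar>w N - w 0\<bar>" "\<bar>w N - w 0\<bar> \<le> R"
    "\<And>i. i < N \<Longrightarrow> \<bar>w (Suc i) - w i\<bar> < c * \<bar>w N - w 0\<bar>"
    "\<And>i. i \<le> N \<Longrightarrow> \<bar>w i - w 0\<bar> \<le> \<bar>w N - w 0\<bar>"
    using thin_chain_at_small_scale[OF D c(1) \<open>0 < R\<close>] by metis
  define l where "l = \<bar>w N - w 0\<bar>"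
  have "0 < l" using w(2) by (simp add: l_def)
  define r where "r = A * l powr \<alpha>"
  have "l powr \<alpha> \<le> R powr \<alpha>"
    using w(3) \<alpha> by (intro powr_mono2) (auto simp: l_def)
  also have "\<dots> = 1 / (2 * A)" using \<alpha> \<open>0 < A\<close> by (simp add: R_def powr_powr)
  finally have r: "0 \<le> r" "r \<le> 1 / 2"
    using \<open>0 < A\<close> by (auto simp: r_def field_simps)
  define F where "F u = gapped_circle r g (4 * pi / l * u)" for u
  have "compact (F u) \<and> F u \<noteq> {} \<and> F u \<subseteq> cball 0 (1 / 2)" for u
    using compact_gapped_circle r g pi_gt3 by (auto simp: F_def gapped_circle_def norm_mult)
  moreover have "\<exists>y\<in>F t. dist x y \<le> \<bar>s - t\<bar> powr \<alpha>" if x: "x \<in> F s" for s t x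
  proof -
    obtain y where "y \<in> F t"
      and y: "dist x y \<le> r * g powr (1 - \<alpha>) * \<bar>4 * pi / l * s - 4 * pi / l * t\<bar> powr \<alpha>"
      using gapped_circle_near[OF r(1) _ _ \<alpha>, of g x "4 * pi / l * s" "4 * pi / l * t"] x g
      by (auto simp: F_def)
    note y
    also have "\<bar>4 * pi / l * s - 4 * pi / l * t\<bar> = 4 * pi / l * \<bar>s - t\<bar>"
      using \<open>0 < l\<close> by (intro abs_mult_diff) simp
    also have "r * g powr (1 - \<alpha>) * (4 * pi / l * \<bar>s - t\<bar>) powr \<alpha>
        = A * g powr (1 - \<alpha>) * (4 * pi) powr \<alpha> * \<bar>s - t\<bar> powr \<alpha>"
      using \<open>0 < l\<close> by (simp add: r_def powr_mult powr_divide)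
    also have "\<dots> \<le> 1 * \<bar>s - t\<bar> powr \<alpha>"
      using gA by (rule mult_right_mono) simp
    finally show ?thesis using \<open>y \<in> F t\<close> by auto
  qed
  moreover have "\<exists>s\<in>D. \<exists>t\<in>D. A * \<bar>s - t\<bar> powr \<alpha> < dist (f s) (f t)"
    if f: "\<forall>u\<in>D. f u \<in> F u" for f
  proof -
    have "f (w i) \<in> gapped_circle (A * l powr \<alpha>) g (4 * pi / l * w i)" if "i \<le> N" for i
      using f w(1)[OF that] by (auto simp: F_def r_def)
    then have "\<exists>i\<le>N. \<exists>j\<le>N. A * \<bar>w i - w j\<bar> powr \<alpha> < dist (f (w i)) (f (w j))"
      using w(4,5) \<open>0 < l\<close> c c_sin g \<alpha> \<open>0 < A\<close>
      by (intro gapped_circle_selection_fast[where c = c and g = g and l = l]) (auto simp: l_def)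
    then show ?thesis using w(1) by blast
  qed
  ultimately show ?thesis by blast
qed

section \<open>A map without Hoelder selections\<close>

lemma summable_dist_fun:
  fixes x y :: "nat \<Rightarrow> 'a :: metric_space"
  shows "summable (\<lambda>n. (1 / 2) ^ n * min (dist (x (from_nat n)) (y (from_nat n))) 1)"
  by (rule summable_comparison_test'[of "\<lambda>n. (1 / 2) ^ n"]) (auto simp: summable_geometric_iff)

lemma dist_fun_le:
  fixes x y :: "nat \<Rightarrow> 'a :: metric_space"
  assumes "\<And>n. dist (x n) (y n) \<le> r"
  shows "dist x y \<le> 2 * r"
proof -
  have *: "(\<lambda>n. (1 / 2 :: real) ^ n * r) sums (2 * r)"
    using sums_mult2[OF geometric_sums[of "1 / 2 :: real"], of r] by simp
  have "dist x y \<le> (\<Sum>n. (1 / 2) ^ n * r)"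
    unfolding dist_fun_def
  proof (rule suminf_le)
    show "(1 / 2) ^ n * min (dist (x (from_nat n)) (y (from_nat n))) 1 \<le> (1 / 2) ^ n * r" for n
      using assms[of "from_nat n"] by (intro mult_left_mono) auto
  qed (use summable_dist_fun sums_summable[OF *] in auto)
  then show ?thesis using sums_unique[OF *] by simp
qed

text \<open>\<open>to_nat\<close> on \<^typ>\<open>nat\<close> is an unspecified injection, not the identity.\<close>

lemma dist_component_le:
  fixes x y :: "nat \<Rightarrow> 'a :: metric_space"
  assumes "dist (x n) (y n) \<le> 1"
  shows "dist (x n) (y n) \<le> 2 ^ to_nat n * dist x y"
proof -
  have "(\<Sum>k\<in>{to_nat n}. (1 / 2) ^ k * min (dist (x (from_nat k)) (y (from_nat k))) 1) \<le> dist x y"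
    unfolding dist_fun_def by (rule sum_le_suminf[OF summable_dist_fun]) auto
  then show ?thesis
    using assms by (simp add: power_divide field_simps)
qed

lemma compact_PiE_UNIV:
  fixes S :: "'i \<Rightarrow> 'a :: topological_space set"
  assumes "\<And>i. compact (S i)"
  shows "compact (PiE UNIV S)"
proof -
  have "compactin (product_topology (\<lambda>i. euclidean) UNIV) (PiE UNIV S)"
    using assms by (simp add: compactin_PiE)
  then show ?thesis by (simp add: euclidean_product_topology)
qed

text \<open>Lets the counterexample live on \<open>real\<close>. A complex number becomes a set of
  naturals tagged by real and imaginary part, a sequence of such sets is merged by pairing, and sets
  of naturals biject with the reals.\<close>

lemma ex_inj_sequences_to_real: "\<exists>h :: (nat \<Rightarrow> complex) \<Rightarrow> real. inj h"
proof -
  obtain b :: "nat set \<Rightarrow> real" where b: "bij b"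
    using nat_sets_eqpoll_reals by (auto simp: eqpoll_def)
  have inj_b: "inj (inv b)" using b by (simp add: bij_is_surj surj_imp_inj_inv)
  define digits where "digits z = sum_encode ` (inv b (Re z) <+> inv b (Im z))" for z
  have digits: "inv b (Re z) = {m. sum_encode (Inl m) \<in> digits z}"
    "inv b (Im z) = {m. sum_encode (Inr m) \<in> digits z}" for z
    by (auto simp: digits_def inj_image_mem_iff[OF inj_sum_encode])
  have inj_digits: "inj digits"
  proof (rule injI)
    fix z z' assume "digits z = digits z'"
    then have "inv b (Re z) = inv b (Re z')" "inv b (Im z) = inv b (Im z')"
      by (simp_all only: digits)
    then show "z = z'"
      by (intro complex_eqI injD[OF inj_b])
  qed
  define code where "code x = {prod_encode (n, m) | n m. m \<in> digits (x n)}" for x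
  have code: "digits (x n) = {m. prod_encode (n, m) \<in> code x}" for x n
    by (auto simp: code_def)
  have "inj (\<lambda>x. b (code x))"
  proof (intro injI ext)
    fix x y n assume "b (code x) = b (code y)"
    then have "code x = code y" using b by (simp add: bij_def inj_eq)
    then have "digits (x n) = digits (y n)" by (simp only: code)
    then show "x n = y n" by (rule injD[OF inj_digits])
  qed
  then show ?thesis by blast
qed

text \<open>Factor \<open>n\<close> defeats the constant \<open>4 ^ to_nat n\<close>. Passing from
  the product metric to that factor costs \<open>2 ^ to_nat n\<close>, so
  \<open>2 ^ to_nat n\<close> is still defeated, and this is unbounded in \<open>n\<close>.\<close>

lemma not_holder_selections_if_not_disconnected:
  assumes D: "\<not> uniformly_disconnected D" "bounded D" and \<alpha>: "0 < \<alpha>" "\<alpha> < 1"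
  shows "\<exists>X :: real metric. \<not> holder_selections \<alpha> D X"
proof -
  define good where "good n F \<longleftrightarrow> (\<forall>u. compact (F u) \<and> F u \<noteq> {} \<and> F u \<subseteq> cball 0 (1 / 2)) \<and>
    (\<forall>s t. \<forall>x\<in>F s. \<exists>y\<in>F t. dist x y \<le> \<bar>s - t\<bar> powr \<alpha>) \<and>
    (\<forall>f. (\<forall>u\<in>D. f u \<in> F u) \<longrightarrow>
      (\<exists>s\<in>D. \<exists>t\<in>D. 4 ^ to_nat n * \<bar>s - t\<bar> powr \<alpha> < dist (f s) (f t)))"
    for n :: nat and F :: "real \<Rightarrow> complex set"
  have "\<exists>F. good n F" for n
    unfolding good_def by (intro exists_fast_selections_only assms) simp
  then obtain F where good: "\<And>n. good n (F n)" by metis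
  then have F: "\<And>n u. compact (F n u)" "\<And>n u. F n u \<noteq> {}" "\<And>n u. F n u \<subseteq> cball 0 (1 / 2)"
    "\<And>n s t x. x \<in> F n s \<Longrightarrow> \<exists>y\<in>F n t. dist x y \<le> \<bar>s - t\<bar> powr \<alpha>"
    "\<And>n f. (\<And>u. u \<in> D \<Longrightarrow> f u \<in> F n u) \<Longrightarrow>
      \<exists>s\<in>D. \<exists>t\<in>D. 4 ^ to_nat n * \<bar>s - t\<bar> powr \<alpha> < dist (f s) (f t)"
    unfolding good_def by blast+
  define P where "P u = PiE UNIV (\<lambda>n. F n u)" for u
  have P: "compact (P u)" "P u \<noteq> {}" for u
    using F(1,2) by (auto simp: P_def compact_PiE_UNIV PiE_eq_empty_iff)
  have P_near: "\<exists>y\<in>P t. dist x y \<le> 2 * \<bar>s - t\<bar> powr \<alpha>" if "x \<in> P s" for s t x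
  proof -
    have "\<exists>y. y \<in> F n t \<and> dist (x n) y \<le> \<bar>s - t\<bar> powr \<alpha>" for n
      using F(4)[of "x n" n s t] that by (auto simp: P_def)
    then obtain y where "\<And>n. y n \<in> F n t" "\<And>n. dist (x n) (y n) \<le> \<bar>s - t\<bar> powr \<alpha>"
      by metis
    then have "y \<in> P t" "dist x y \<le> 2 * \<bar>s - t\<bar> powr \<alpha>"
      using dist_fun_le[of x y] by (auto simp: P_def)
    then show ?thesis by blast
  qed
  obtain h :: "(nat \<Rightarrow> complex) \<Rightarrow> real" where h: "inj h"
    using ex_inj_sequences_to_real by (rule exE)
  \<comment> \<open>The product metric is transported to \<open>range h\<close>, making
    \<open>h\<close> an isometry, so compactness and distances carry over.\<close>
  define d where "d x y = dist (inv h x) (inv h y)" for x y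
  have d_h: "d (h x) (h y) = dist x y" for x y
    by (simp add: d_def inv_f_f[OF h])
  interpret M: Metric_space "range h" d
    by standard (auto simp: d_def dist_commute dist_triangle inv_f_f[OF h])
  interpret H: Metric_space12 "UNIV :: (nat \<Rightarrow> complex) set" dist "range h" d ..
  define X where "X = metric (range h, d)"
  have X: "mdist X = d" "mtopology_of X = M.mtopology"
    unfolding X_def by (rule M.mdist_metric M.mtopology_of)+
  have "embedding_map euclidean M.mtopology h"
    using H.isometry_imp_embedding_map[of h] d_h by simp
  then have "continuous_map euclidean M.mtopology h"
    unfolding embedding_map_def continuous_map_in_subtopology
    by (blast dest: homeomorphic_imp_continuous_map[THEN continuous_map_into_fulltopology])
  then have compacts: "h ` P u \<in> nonempty_compacts X" for u
    using P image_compactin[of euclidean "P u" M.mtopology h] by (simp add: nonempty_compacts_def X)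
  have "hausdorff_dist X (h ` P u) (h ` P v) \<le> 2 * \<bar>u - v\<bar> powr \<alpha>" for u v
  proof (rule hausdorff_dist_leI)
    show "\<exists>b\<in>h ` P v. mdist X a b \<le> 2 * \<bar>u - v\<bar> powr \<alpha>" if "a \<in> h ` P u" for a
      using P_near[of _ u v] that by (auto simp: X d_h)
    show "\<exists>a\<in>h ` P u. mdist X a b \<le> 2 * \<bar>u - v\<bar> powr \<alpha>" if "b \<in> h ` P v" for b
      using P_near[of _ v u] that by (auto simp: X d_h dist_commute abs_minus_commute)
  qed (use P in auto)
  then have setmap: "holder_setmap \<alpha> D X (\<lambda>u. h ` P u)"
    using compacts unfolding holder_setmap_def holder_on_def
    by (auto intro!: exI[of _ 2] simp: holder_bound_def)
  have "\<not> holder_on \<alpha> D (mdist X) f" if f: "selection_on D (\<lambda>u. h ` P u) f" for f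
  proof
    assume "holder_on \<alpha> D (mdist X) f"
    then obtain L where L: "\<And>u v. u \<in> D \<Longrightarrow> v \<in> D \<Longrightarrow> d (f u) (f v) \<le> L * \<bar>u - v\<bar> powr \<alpha>"
      by (auto simp: holder_on_def holder_bound_def X)
    define k where "k u = inv h (f u)" for u
    have k: "k u n \<in> F n u" if "u \<in> D" for u n
      using f that h by (auto simp: k_def P_def selection_on_def PiE_def Pi_def) 
    obtain K where K: "L < 2 ^ K" using real_arch_pow[of 2 L] by auto
    have "infinite (range (to_nat :: nat \<Rightarrow> nat))"
      by (simp add: finite_image_iff)
    then obtain n :: nat where n: "K < to_nat n"
      unfolding infinite_nat_iff_unbounded by blast
    have "(2 :: real) ^ K \<le> 2 ^ to_nat n" using n by simp
    then have n: "L < 2 ^ to_nat n" using K by linarith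
    obtain s t where st: "s \<in> D" "t \<in> D" "4 ^ to_nat n * \<bar>s - t\<bar> powr \<alpha> < dist (k s n) (k t n)"
      using F(5)[of "\<lambda>u. k u n" n] k by blast
    \<comment> \<open>Both components lie in the ball of radius \<open>1 / 2\<close>, so the
      truncation in the product metric is inactive.\<close>
    have "dist (k s n) (k t n) \<le> dist (k s n) 0 + dist 0 (k t n)" by (rule dist_triangle)
    also have "\<dots> \<le> 1 / 2 + 1 / 2"
      using subsetD[OF F(3) k[OF st(1), of n]] subsetD[OF F(3) k[OF st(2), of n]]
      by (intro add_mono) auto
    finally have "dist (k s n) (k t n) \<le> 2 ^ to_nat n * dist (k s) (k t)"
      by (intro dist_component_le) simp
    also have "\<dots> \<le> 2 ^ to_nat n * (L * \<bar>s - t\<bar> powr \<alpha>)"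
      using L[OF st(1,2)] by (simp add: d_def k_def)
    also have "\<dots> \<le> 2 ^ to_nat n * (2 ^ to_nat n * \<bar>s - t\<bar> powr \<alpha>)"
      using n by (intro mult_left_mono mult_right_mono) auto
    also have "\<dots> = (2 * 2) ^ to_nat n * \<bar>s - t\<bar> powr \<alpha>"
      unfolding power_mult_distrib by (rule mult.assoc[symmetric])
    finally show False using st(3) by simp
  qed
  then show ?thesis
    using setmap unfolding holder_selections_def by blast
qed

section \<open>Closing the cycle of implications\<close>

lemma holder_selections_if_pointed:
  assumes "pointed_holder_selections \<alpha> D C X" "D \<noteq> {}"
  shows "holder_selections \<alpha> D X"
  unfolding holder_selections_def
proof (intro allI impI)
  fix F assume F: "holder_setmap \<alpha> D X F"
  obtain u where u: "u \<in> D" using \<open>D \<noteq> {}\<close> by blast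
  then have "F u \<in> nonempty_compacts X" using F by (auto simp: holder_setmap_def)
  then obtain x where "x \<in> F u" by (auto simp: nonempty_compacts_def)
  then show "\<exists>f. selection_on D F f \<and> holder_on \<alpha> D (mdist X) f"
    using assms(1) F u unfolding pointed_holder_selections_def by blast
qed

theorem theorem4p4:
  fixes \<alpha> :: real and D :: "real set"
  assumes "0 < \<alpha>" and "\<alpha> < 1" and "D \<noteq> {}" and "bounded D"
  shows
    "(uniformly_disconnected D \<longleftrightarrow>
        (\<forall>X :: 'a metric. holder_selections \<alpha> D X) \<and>
        (\<forall>X :: real metric. holder_selections \<alpha> D X)) \<and>
     (uniformly_disconnected D \<longleftrightarrow>
        (\<exists>C. (\<forall>X :: 'a metric. pointed_holder_selections \<alpha> D C X) \<and>
             (\<forall>X :: real metric. pointed_holder_selections \<alpha> D C X))) \<and>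
     (\<forall>c. 0 < c \<and> c \<le> 1 \<and> c_uniformly_disconnected c D \<longrightarrow>
        (\<forall>X :: 'a metric. pointed_holder_selections \<alpha> D (8 * c powr (- \<alpha>)) X) \<and>
        (\<forall>X :: real metric. pointed_holder_selections \<alpha> D (8 * c powr (- \<alpha>)) X))"
proof -
  let ?i = "uniformly_disconnected D"
  let ?ii = "(\<forall>X :: 'a metric. holder_selections \<alpha> D X) \<and>
    (\<forall>X :: real metric. holder_selections \<alpha> D X)"
  let ?P = "\<lambda>C. (\<forall>X :: 'a metric. pointed_holder_selections \<alpha> D C X) \<and>
    (\<forall>X :: real metric. pointed_holder_selections \<alpha> D C X)"
  have const: "?P (8 * c powr (- \<alpha>))" if "0 < c" "c_uniformly_disconnected c D" for c
    by (intro conjI allI pointed_holder_selections_if_disconnected assms that)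
  \<comment> \<open>The cycle is (i) to (iii) to (ii) to (i); its last link uses the counterexample
    on \<open>real\<close>.\<close>
  have "?i \<Longrightarrow> \<exists>C. ?P C"
    using const unfolding uniformly_disconnected_def by blast
  moreover have "\<exists>C. ?P C \<Longrightarrow> ?ii"
    by (elim exE conjE, intro conjI allI; rule holder_selections_if_pointed[OF _ assms(3)]; blast)
  moreover have "?ii \<Longrightarrow> ?i"
    using not_holder_selections_if_not_disconnected[OF _ assms(4,1,2)] by blast
  ultimately show ?thesis
    using const by blast
qed

end
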